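(* Let $G$ be a finite abstract simplicial complex and let $t$ be a nonzero real number. Define matrices $L_t$ and $g_t$ indexed by $G\times G$ by $$L_t(x,y)=1-\frac{f_{W^-(x)\cap W^-(y)}(t)}{t^{|x\cap y|}},\qquad g_t(x,y)=\omega(x)\,\omega(y)\,\bigl(1-f_{W^+(x)\cap W^+(y)}(t)\bigr).$$ Then $g_t=L_t^{-1}$.
   Context: A finite abstract simplicial complex $G$ is a finite set of finite non-empty sets closed under the operation of taking non-empty subsets. For $x\in G$ let $W^+(x)=\{y\in G: x\subset y\}$ and $W^-(x)=\{y\in G: y\subset x\}$ (both include $x$). Let $|x|$ be the cardinality of $x$, $\dim(x)=|x|-1$ and $\omega(x)=(-1)^{\dim(x)}$. For any subset $A\subset G$ (not necessarily a subcomplex), $f_A(t)=1+f_0t+f_1t^2+\cdots+f_dt^{d+1}$, where $f_k$ is the number of elements of $A$ of dimension $k$; that is, $f_A(t)=1+\sum_{x\in A}t^{|x|}$, with $f_\emptyset(t)=1$. *)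

theory Defs
  imports Complex_Main "Jordan_Normal_Form.Matrix"
begin

definition abstract_simplicial_complex :: "'a set set \<Rightarrow> bool" where
  "abstract_simplicial_complex G \<longleftrightarrow>
     finite G \<and>
     (\<forall>x\<in>G. finite x \<and> x \<noteq> {}) \<and>
     (\<forall>x\<in>G. \<forall>y. y \<subseteq> x \<and> y \<noteq> {} \<longrightarrow> y \<in> G)"

definition W_plus :: "'a set set \<Rightarrow> 'a set \<Rightarrow> 'a set set" where
  "W_plus G x = {y \<in> G. x \<subseteq> y}"

definition W_minus :: "'a set set \<Rightarrow> 'a set \<Rightarrow> 'a set set" where
  "W_minus G x = {y \<in> G. y \<subseteq> x}"

(* Simplices are non-empty, so the truncated subtraction is never truncating. *)
definition simplex_dim :: "'a set \<Rightarrow> nat" where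
  "simplex_dim x = card x - 1"

definition omega :: "'a set \<Rightarrow> real" where
  "omega x = (-1) ^ simplex_dim x"

(* Grouping the sum by dimension gives 1 + f_0 t + f_1 t^2 + ... + f_d t^(d+1),
   where f_k is the number of k-dimensional elements of A. *)
definition f_fun :: "'a set set \<Rightarrow> real \<Rightarrow> real" where
  "f_fun A t = 1 + (\<Sum>x\<in>A. t ^ card x)"

definition L_entry :: "'a set set \<Rightarrow> real \<Rightarrow> 'a set \<Rightarrow> 'a set \<Rightarrow> real" where
  "L_entry G t x y = 1 - f_fun (W_minus G x \<inter> W_minus G y) t / t ^ card (x \<inter> y)"

definition g_entry :: "'a set set \<Rightarrow> real \<Rightarrow> 'a set \<Rightarrow> 'a set \<Rightarrow> real" where
  "g_entry G t x y = omega x * omega y * (1 - f_fun (W_plus G x \<inter> W_plus G y) t)"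

(* The list xs enumerates the index set: row i and column j belong to xs ! i and xs ! j. *)
definition indexed_mat :: "'a list \<Rightarrow> ('a \<Rightarrow> 'a \<Rightarrow> real) \<Rightarrow> real mat" where
  "indexed_mat xs M = mat (length xs) (length xs) (\<lambda>(i, j). M (xs ! i) (xs ! j))"

end

theory Submission
  imports Defs
begin

text \<open>
  Let \<open>Z\<close> be the zeta matrix of the inclusion order on \<open>G\<close>, with entries \<open>Z x y = [x \<subseteq> y]\<close>, let
  \<open>\<Omega>\<close> be the diagonal matrix of the signs \<open>omega x\<close>, and let \<open>D s\<close> be the diagonal matrix with
  entries \<open>s ^ card x\<close>.  Both matrices of the theorem factor through \<open>Z\<close>:
  \<open>L = - Z\<^sup>T (D (1/t)) Z\<close> and \<open>g = - \<Omega> Z (D t) Z\<^sup>T \<Omega>\<close>.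

  The second factorization only unfolds definitions (lemma \<open>g_entry_eq\<close>).  For the
  first one, the non-empty subsets of \<open>x \<inter> y\<close> all lie in \<open>G\<close>, so the binomial theorem gives
  \<open>f(t) = (1 + t)\<^sup>n\<close> with \<open>n = card (x \<inter> y)\<close>; hence \<open>f(t) / t\<^sup>n = (1 + 1/t)\<^sup>n\<close>, which is again a
  generating function of the same faces, now evaluated at \<open>1/t\<close> (lemma \<open>L_entry_eq\<close>).

  Moebius inversion in the face poset of a simplicial complex says \<open>Z\<^sup>-\<^sup>1 = \<Omega> Z \<Omega>\<close>, because
  intervals of this poset are Boolean lattices (lemma \<open>sum_omega_interval\<close>).  With
  \<open>D (1/t) (D t) = 1\<close> the product \<open>L g\<close> collapses to the identity; the inversion is used once for
  \<open>Z\<close> and once for \<open>Z\<^sup>T\<close>.  As \<open>L\<close> and \<open>g\<close> are symmetric, \<open>g L\<close> is the transpose of \<open>L g\<close>.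
\<close>

lemma sum_power_card_Pow:
  fixes c :: "'b :: comm_semiring_1"
  assumes "finite A"
  shows "(\<Sum>X\<in>Pow A. c ^ card X) = (1 + c) ^ card A"
  using prod_add[OF assms, of "\<lambda>_. c" "\<lambda>_. 1"] by (simp add: add.commute)

lemma omega_eq:
  assumes "finite x" "x \<noteq> {}"
  shows "omega x = - ((-1) ^ card x)"
proof -
  obtain n where "card x = Suc n"
    using assms by (metis card_eq_0_iff not0_implies_Suc)
  then show ?thesis by (simp add: omega_def simplex_dim_def)
qed

lemma omega_square: "omega x * omega x = 1"
  by (simp add: omega_def flip: power_mult_distrib)

text \<open>
  Between \<open>a\<close> and a strictly larger \<open>b\<close> there are as many sets of even as of odd cardinality.  The
  bottom \<open>a\<close> has to be non-empty since the rule \<open>omega z = - ((-1) ^ card z)\<close> fails at \<open>z = {}\<close>.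
\<close>
lemma sum_omega_interval:
  assumes "finite b" "a \<noteq> {}"
  shows "(\<Sum>z | a \<subseteq> z \<and> z \<subseteq> b. omega z) = (if a = b then omega a else 0)"
proof -
  consider "\<not> a \<subseteq> b" | "a = b" | "a \<subset> b" by blast
  then show ?thesis
  proof cases
    case 1
    then have empty: "{z. a \<subseteq> z \<and> z \<subseteq> b} = {}" and "a \<noteq> b" by auto
    then show ?thesis by (simp only: empty sum.empty if_False)
  next
    case 2
    then have "{z. a \<subseteq> z \<and> z \<subseteq> b} = {a}" by auto
    then show ?thesis using 2 by simp
  next
    case 3
    let ?I = "{z. a \<subseteq> z \<and> z \<subseteq> b}"
    have "finite ?I"
      by (rule finite_subset[of _ "Pow b"]) (use assms in auto)
    moreover have "card {z \<in> ?I. even (card z)} = card {z \<in> ?I. odd (card z)}"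
      using card_subsupersets_even_odd[OF \<open>finite b\<close> 3] by (simp add: conj_ac)
    ultimately have "(\<Sum>z\<in>?I. (-1) ^ card z) = (0 :: real)"
      by (rule sum_alternating_cancels)
    moreover have "omega z = - ((-1) ^ card z)" if "z \<in> ?I" for z
      using that assms by (intro omega_eq) (auto intro: finite_subset)
    ultimately show ?thesis
      using 3 by (simp add: sum_negf)
  qed
qed

context
  fixes G :: "'a set set"
  assumes complex: "abstract_simplicial_complex G"
begin

lemma finite_complex: "finite G"
  and finite_simplex: "x \<in> G \<Longrightarrow> finite x"
  and simplex_nonempty: "x \<in> G \<Longrightarrow> x \<noteq> {}"
  and face_in_complex: "x \<in> G \<Longrightarrow> y \<subseteq> x \<Longrightarrow> y \<noteq> {} \<Longrightarrow> y \<in> G"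
  using complex unfolding abstract_simplicial_complex_def by blast+

text \<open>Closure under faces makes every interval of \<open>G\<close> a full interval of the subset lattice.\<close>
lemma sum_omega_complex_interval:
  assumes "a \<in> G" "b \<in> G"
  shows "(\<Sum>z | z \<in> G \<and> a \<subseteq> z \<and> z \<subseteq> b. omega z) = (if a = b then omega a else 0)"
proof -
  have "{z. z \<in> G \<and> a \<subseteq> z \<and> z \<subseteq> b} = {z. a \<subseteq> z \<and> z \<subseteq> b}"
    using assms simplex_nonempty face_in_complex by blast
  then show ?thesis
    using assms by (simp add: sum_omega_interval finite_simplex simplex_nonempty)
qed

text \<open>The constant term of \<open>f_fun\<close> stands for the empty set, the only subset of \<open>w\<close> outside \<open>G\<close>.\<close>
lemma f_fun_faces:
  assumes "x \<in> G" "w \<subseteq> x"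
  shows "f_fun {z \<in> G. z \<subseteq> w} s = (1 + s) ^ card w"
proof -
  have "finite w" using assms finite_simplex finite_subset by blast
  have "{} \<notin> G" using simplex_nonempty by blast
  have "Pow w = insert {} {z \<in> G. z \<subseteq> w}"
    using assms face_in_complex by blast
  then have "(\<Sum>z\<in>Pow w. s ^ card z) = f_fun {z \<in> G. z \<subseteq> w} s"
    using finite_complex \<open>{} \<notin> G\<close> by (simp add: f_fun_def)
  then show ?thesis using sum_power_card_Pow[OF \<open>finite w\<close>] by metis
qed

text \<open>
  Division by \<open>t ^ card (x \<inter> y)\<close> turns \<open>1 + t\<close> into \<open>1 + 1 / t\<close>; expanding by \<open>f_fun_faces\<close> at
  \<open>1 / t\<close> gives back a sum over the common faces of \<open>x\<close> and \<open>y\<close>.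
\<close>
lemma L_entry_eq:
  assumes "x \<in> G" "t \<noteq> 0"
  shows "L_entry G t x y = - (\<Sum>a | a \<in> G \<and> a \<subseteq> x \<and> a \<subseteq> y. (1 / t) ^ card a)"
proof -
  have faces: "W_minus G x \<inter> W_minus G y = {z \<in> G. z \<subseteq> x \<inter> y}"
    by (auto simp: W_minus_def)
  have "L_entry G t x y = 1 - ((1 + t) / t) ^ card (x \<inter> y)"
    unfolding L_entry_def faces f_fun_faces[OF \<open>x \<in> G\<close> Int_lower1] by (simp add: power_divide)
  also have "(1 + t) / t = 1 + 1 / t"
    using assms by (simp add: field_simps)
  also have "(1 + 1 / t) ^ card (x \<inter> y) = f_fun {z \<in> G. z \<subseteq> x \<inter> y} (1 / t)"
    using f_fun_faces[OF \<open>x \<in> G\<close> Int_lower1] by simp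
  finally show ?thesis
    by (simp add: f_fun_def)
qed

lemma g_entry_eq:
  "g_entry G t x y = - (omega x * omega y * (\<Sum>b | b \<in> G \<and> x \<subseteq> b \<and> y \<subseteq> b. t ^ card b))"
proof -
  have "W_plus G x \<inter> W_plus G y = {b. b \<in> G \<and> x \<subseteq> b \<and> y \<subseteq> b}"
    by (auto simp: W_plus_def)
  then show ?thesis by (simp add: g_entry_def f_fun_def)
qed

text \<open>
  In matrix form, \<open>Z \<Omega> Z = \<Omega>\<close> reduces \<open>Z\<^sup>T (D (1/t)) Z \<Omega> Z (D t) Z\<^sup>T \<Omega>\<close> to \<open>Z\<^sup>T \<Omega> Z\<^sup>T \<Omega>\<close>, which is
  the identity by the transpose of the same relation.  Below, \<open>a\<close> and \<open>b\<close> are the summation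
  variables of the factorizations of \<open>L\<close> and \<open>g\<close>.
\<close>
lemma sum_L_entry_g_entry:
  assumes "x \<in> G" "y \<in> G" "t \<noteq> 0"
  shows "(\<Sum>z\<in>G. L_entry G t x z * g_entry G t z y) = (if x = y then 1 else 0)"
proof -
  let ?A = "{a \<in> G. a \<subseteq> x}" and ?B = "{b \<in> G. y \<subseteq> b}"
  note fin = finite_complex
  have "L_entry G t x z * g_entry G t z y
      = (\<Sum>a\<in>?A. \<Sum>b\<in>?B. omega y * (1 / t) ^ card a * t ^ card b *
           (if a \<subseteq> z \<and> z \<subseteq> b then omega z else 0))" for z
  proof -
    have "L_entry G t x z = - (\<Sum>a\<in>?A. if a \<subseteq> z then (1 / t) ^ card a else 0)"
      unfolding L_entry_eq[OF \<open>x \<in> G\<close> \<open>t \<noteq> 0\<close>] using fin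
      by (simp add: conj_ac flip: sum.inter_filter)
    moreover have "g_entry G t z y
        = - (omega z * omega y * (\<Sum>b\<in>?B. if z \<subseteq> b then t ^ card b else 0))"
      unfolding g_entry_eq using fin
      by (simp add: conj_ac flip: sum.inter_filter)
    ultimately have "L_entry G t x z * g_entry G t z y
        = (\<Sum>a\<in>?A. if a \<subseteq> z then (1 / t) ^ card a else 0) *
          (\<Sum>b\<in>?B. omega z * omega y * (if z \<subseteq> b then t ^ card b else 0))"
      by (simp only: minus_mult_minus sum_distrib_left)
    also have "\<dots> = (\<Sum>a\<in>?A. \<Sum>b\<in>?B. omega y * (1 / t) ^ card a * t ^ card b *
        (if a \<subseteq> z \<and> z \<subseteq> b then omega z else 0))"
      unfolding sum_product by (intro sum.cong refl) simp
    finally show ?thesis .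
  qed
  then have "(\<Sum>z\<in>G. L_entry G t x z * g_entry G t z y)
      = (\<Sum>z\<in>G. \<Sum>a\<in>?A. \<Sum>b\<in>?B. omega y * (1 / t) ^ card a * t ^ card b *
           (if a \<subseteq> z \<and> z \<subseteq> b then omega z else 0))"
    by simp
  also have "\<dots> = (\<Sum>a\<in>?A. \<Sum>b\<in>?B. \<Sum>z\<in>G. omega y * (1 / t) ^ card a * t ^ card b *
           (if a \<subseteq> z \<and> z \<subseteq> b then omega z else 0))"
    by (rule trans[OF sum.swap], rule sum.cong[OF refl], rule sum.swap)
  also have "\<dots> = (\<Sum>a\<in>?A. \<Sum>b\<in>?B. if a = b then omega y * omega a else 0)"
  proof (intro sum.cong refl)
    fix a b assume "a \<in> ?A" "b \<in> ?B"
    \<comment> \<open>Inversion forces \<open>a = b\<close>, and then the powers of \<open>1/t\<close> and \<open>t\<close> cancel.\<close>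
    then have inversion:
      "(\<Sum>z\<in>G. if a \<subseteq> z \<and> z \<subseteq> b then omega z else 0) = (if a = b then omega a else 0)"
      using fin by (simp add: sum_omega_complex_interval flip: sum.inter_filter)
    then show "(\<Sum>z\<in>G. omega y * (1 / t) ^ card a * t ^ card b *
        (if a \<subseteq> z \<and> z \<subseteq> b then omega z else 0)) = (if a = b then omega y * omega a else 0)"
      unfolding sum_distrib_left[symmetric] inversion
      using \<open>t \<noteq> 0\<close> by (simp add: power_divide)
  qed
  also have "\<dots> = (\<Sum>a\<in>?A. if a \<in> ?B then omega y * omega a else 0)"
    using fin by (intro sum.cong refl) (simp add: sum.delta')
  also have "\<dots> = (\<Sum>a | a \<in> G \<and> y \<subseteq> a \<and> a \<subseteq> x. omega y * omega a)"
    using fin by (intro sum.mono_neutral_cong_right) auto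
  \<comment> \<open>The sum left over runs over the interval from \<open>y\<close> to \<open>x\<close>.\<close>
  also have "\<dots> = omega y * (if y = x then omega y else 0)"
    using sum_omega_complex_interval[of y x] assms by (simp flip: sum_distrib_left)
  also have "\<dots> = (if x = y then 1 else 0)"
    by (simp add: omega_square)
  finally show ?thesis .
qed

end

lemma L_entry_commute: "L_entry G t x y = L_entry G t y x"
  by (simp add: L_entry_def Int_commute)

lemma g_entry_commute: "g_entry G t x y = g_entry G t y x"
  by (simp add: g_entry_def Int_commute mult.commute)

lemma inverts_indexed_mat:
  assumes "distinct xs"
    and "\<And>x y. x \<in> set xs \<Longrightarrow> y \<in> set xs \<Longrightarrow>
           (\<Sum>z\<in>set xs. A x z * B z y) = (if x = y then 1 else 0)"
  shows "inverts_mat (indexed_mat xs A) (indexed_mat xs B)"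
  unfolding inverts_mat_def
proof (rule eq_matI)
  fix i j
  assume "i < dim_row (1\<^sub>m (dim_row (indexed_mat xs A)))"
    and "j < dim_col (1\<^sub>m (dim_row (indexed_mat xs A)))"
  then have ij: "i < length xs" "j < length xs"
    by (simp_all add: indexed_mat_def)
  have "(indexed_mat xs A * indexed_mat xs B) $$ (i, j)
      = (\<Sum>k<length xs. A (xs ! i) (xs ! k) * B (xs ! k) (xs ! j))"
    using ij by (simp add: indexed_mat_def scalar_prod_def atLeast0LessThan)
  also have "\<dots> = (\<Sum>z\<in>set xs. A (xs ! i) z * B z (xs ! j))"
    by (rule sum.reindex_bij_betw[OF bij_betw_nth[OF \<open>distinct xs\<close> refl refl]])
  also have "\<dots> = (if i = j then 1 else 0)"
    using ij assms by (simp add: nth_eq_iff_index_eq)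
  finally show "(indexed_mat xs A * indexed_mat xs B) $$ (i, j)
      = 1\<^sub>m (dim_row (indexed_mat xs A)) $$ (i, j)"
    using ij by (simp add: indexed_mat_def)
qed (simp_all add: indexed_mat_def)

theorem theorem9:
  fixes G :: "'a set set" and t :: real and xs :: "'a set list"
  assumes "abstract_simplicial_complex G"
    and "t \<noteq> 0"
    and "distinct xs" and "set xs = G"
  shows "inverts_mat (indexed_mat xs (L_entry G t)) (indexed_mat xs (g_entry G t)) \<and>
         inverts_mat (indexed_mat xs (g_entry G t)) (indexed_mat xs (L_entry G t))"
proof
  note sum_L_g = sum_L_entry_g_entry[OF assms(1) _ _ assms(2)]
  show "inverts_mat (indexed_mat xs (L_entry G t)) (indexed_mat xs (g_entry G t))"
    using assms sum_L_g by (intro inverts_indexed_mat) auto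
  show "inverts_mat (indexed_mat xs (g_entry G t)) (indexed_mat xs (L_entry G t))"
  proof (rule inverts_indexed_mat[OF \<open>distinct xs\<close>])
    fix x y assume "x \<in> set xs" "y \<in> set xs"
    moreover have "(\<Sum>z\<in>set xs. g_entry G t x z * L_entry G t z y)
        = (\<Sum>z\<in>set xs. L_entry G t y z * g_entry G t z x)"
      by (intro sum.cong refl) (metis L_entry_commute g_entry_commute mult.commute)
    ultimately show "(\<Sum>z\<in>set xs. g_entry G t x z * L_entry G t z y) = (if x = y then 1 else 0)"
      using assms sum_L_g by auto
  qed
qed

end
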